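(* Let $G=(V,V_0,V_1,E,c)$ be a parity game, $p\in\{0,1\}$, and $X\subseteq V$ a nonempty set of nodes all of whose colors have parity $p$. Suppose $\mathtt{layeredAttr}(G,p,X)$ is fatal, i.e. $X\subseteq\mathtt{layeredAttr}(G,p,X)$. Then the layered attractor strategy of player $p$ is winning for player $p$ on $\mathtt{layeredAttr}(G,p,X)$: every play starting in $\mathtt{layeredAttr}(G,p,X)$ and consistent with it is won by player $p$.
   Context: A parity game is a tuple $G=(V,V_0,V_1,E,c)$ where $V$ is a finite set of nodes partitioned into $V_0,V_1$, $E\subseteq V\times V$ with every node having a successor, and $c\colon V\to\mathbb{N}$. Let $v.E=\{w\mid(v,w)\in E\}$. In a play the owner of the current node chooses the next node; player $0$ wins a play iff the minimal color occurring infinitely often is even, else player $1$ wins. A strategy for player $p$ is a map $\tau\colon V_p\to V$ along edges; a play is consistent with it if player $p$'s moves follow $\tau$. Permissive monotone predecessor: $\mathrm{pmpre}_p(A,T,d)=\{v\in V_p\mid (c(v)\geq d\vee v\in T)\wedge v.E\cap(A\cup T)\neq\emptyset\}\cup\{v\in V_{1-p}\mid (c(v)\geq d\vee v\in T)\wedge v.E\subseteq A\cup T\}$. Let $b=\max\{c(v)\mid v\in X\}$. For $d=p,p+2,\dots,b$ let $Y_d=\{v\in X\mid c(v)\leq d\}$; set $A_{p-2}=\emptyset$, and let $A_{d,0}=\emptyset$, $A_{d,i+1}=\mathrm{pmpre}_p(A_{d,i},A_{d-2}\cup Y_d,d)$, $A_d=\bigcup_i A_{d,i}$ (least fixed point).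 Define $\mathtt{layeredAttr}(G,p,X)=A_b$; it is fatal if $X\subseteq A_b$. For $v\in A_b$ let $r(v)$ be the lexicographically least pair $(d,i)$ with $v\in A_{d,i}$. The layered attractor strategy of player $p$ chooses, at each $v\in V_p\cap A_b$ with $r(v)=(d,i)$, a successor of $v$ in $A_{d,i-1}\cup A_{d-2}\cup Y_d$ (which exists by definition). *)

theory Defs
  imports Main "HOL-Library.Product_Lexorder"
begin

record 'v pgame =
  nodes :: "'v set"
  nodes0 :: "'v set"
  nodes1 :: "'v set"
  edges :: "('v \<times> 'v) set"
  color :: "'v \<Rightarrow> nat"

definition parity_game :: "'v pgame \<Rightarrow> bool" where
  "parity_game G \<longleftrightarrow>
     finite (nodes G) \<and>
     nodes0 G \<union> nodes1 G = nodes G \<and> nodes0 G \<inter> nodes1 G = {} \<and>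
     edges G \<subseteq> nodes G \<times> nodes G \<and>
     (\<forall>v\<in>nodes G. \<exists>w. (v, w) \<in> edges G)"

text \<open>Players are the natural numbers 0 and 1; the opponent of \<open>p\<close> is \<open>1 - p\<close>.\<close>

definition owned :: "'v pgame \<Rightarrow> nat \<Rightarrow> 'v set" where
  "owned G p = (if p = 0 then nodes0 G else nodes1 G)"

definition succs :: "'v pgame \<Rightarrow> 'v \<Rightarrow> 'v set" where
  "succs G v = {w. (v, w) \<in> edges G}"

definition play :: "'v pgame \<Rightarrow> (nat \<Rightarrow> 'v) \<Rightarrow> bool" where
  "play G \<pi> \<longleftrightarrow> \<pi> 0 \<in> nodes G \<and> (\<forall>n. \<pi> (Suc n) \<in> succs G (\<pi> n))"

definition winner :: "'v pgame \<Rightarrow> (nat \<Rightarrow> 'v) \<Rightarrow> nat" where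
  "winner G \<pi> =
     (if even (LEAST k. \<exists>\<^sub>\<infinity>n. color G (\<pi> n) = k) then 0 else 1)"

text \<open>Only the values of \<open>\<tau>\<close> on the nodes owned by \<open>p\<close> matter.\<close>

definition strategy :: "'v pgame \<Rightarrow> nat \<Rightarrow> ('v \<Rightarrow> 'v) \<Rightarrow> bool" where
  "strategy G p \<tau> \<longleftrightarrow> (\<forall>v\<in>owned G p. \<tau> v \<in> succs G v)"

definition consistent :: "'v pgame \<Rightarrow> nat \<Rightarrow> ('v \<Rightarrow> 'v) \<Rightarrow> (nat \<Rightarrow> 'v) \<Rightarrow> bool" where
  "consistent G p \<tau> \<pi> \<longleftrightarrow> (\<forall>n. \<pi> n \<in> owned G p \<longrightarrow> \<pi> (Suc n) = \<tau> (\<pi> n))"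

definition winning_on :: "'v pgame \<Rightarrow> nat \<Rightarrow> ('v \<Rightarrow> 'v) \<Rightarrow> 'v set \<Rightarrow> bool" where
  "winning_on G p \<tau> W \<longleftrightarrow>
     (\<forall>\<pi>. play G \<pi> \<and> \<pi> 0 \<in> W \<and> consistent G p \<tau> \<pi> \<longrightarrow> winner G \<pi> = p)"

definition pmpre :: "'v pgame \<Rightarrow> nat \<Rightarrow> 'v set \<Rightarrow> 'v set \<Rightarrow> nat \<Rightarrow> 'v set" where
  "pmpre G p A T d =
     {v \<in> owned G p. (color G v \<ge> d \<or> v \<in> T) \<and> succs G v \<inter> (A \<union> T) \<noteq> {}} \<union>
     {v \<in> owned G (1 - p). (color G v \<ge> d \<or> v \<in> T) \<and> succs G v \<subseteq> A \<union> T}"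

primrec pmpre_iter :: "'v pgame \<Rightarrow> nat \<Rightarrow> 'v set \<Rightarrow> nat \<Rightarrow> nat \<Rightarrow> 'v set" where
  "pmpre_iter G p T d 0 = {}"
| "pmpre_iter G p T d (Suc i) = pmpre G p (pmpre_iter G p T d i) T d"

definition targets :: "'v pgame \<Rightarrow> 'v set \<Rightarrow> nat \<Rightarrow> 'v set" where
  "targets G X d = {v \<in> X. color G v \<le> d}"

text \<open>
  \<open>layer G p X d\<close> is $A_d$ and \<open>prev_layer G p X d\<close> is $A_{d-2}$, where the case
  distinction realises $A_{p-2} = \emptyset$. Both are only meaningful
  for \<open>d \<in> levels G p X\<close>.
\<close>

fun layer :: "'v pgame \<Rightarrow> nat \<Rightarrow> 'v set \<Rightarrow> nat \<Rightarrow> 'v set" where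
  "layer G p X d =
     (\<Union>i. pmpre_iter G p ((if d < p + 2 then {} else layer G p X (d - 2)) \<union> targets G X d) d i)"

declare layer.simps [simp del]

definition prev_layer :: "'v pgame \<Rightarrow> nat \<Rightarrow> 'v set \<Rightarrow> nat \<Rightarrow> 'v set" where
  "prev_layer G p X d = (if d < p + 2 then {} else layer G p X (d - 2))"

text \<open>$A_{d,i}$\<close>

definition stage :: "'v pgame \<Rightarrow> nat \<Rightarrow> 'v set \<Rightarrow> nat \<Rightarrow> nat \<Rightarrow> 'v set" where
  "stage G p X d i = pmpre_iter G p (prev_layer G p X d \<union> targets G X d) d i"

lemma layer_eq_UN_stage: "layer G p X d = (\<Union>i. stage G p X d i)"
  by (subst layer.simps) (simp add: stage_def prev_layer_def)

definition max_color :: "'v pgame \<Rightarrow> 'v set \<Rightarrow> nat" where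
  "max_color G X = Max (color G ` X)"

definition layered_attr :: "'v pgame \<Rightarrow> nat \<Rightarrow> 'v set \<Rightarrow> 'v set" where
  "layered_attr G p X = layer G p X (max_color G X)"

definition fatal :: "'v pgame \<Rightarrow> nat \<Rightarrow> 'v set \<Rightarrow> bool" where
  "fatal G p X \<longleftrightarrow> X \<subseteq> layered_attr G p X"

definition levels :: "'v pgame \<Rightarrow> nat \<Rightarrow> 'v set \<Rightarrow> nat set" where
  "levels G p X = {d. p \<le> d \<and> d \<le> max_color G X \<and> d mod 2 = p}"

text \<open>The order on pairs is the lexicographic one.\<close>

definition rank :: "'v pgame \<Rightarrow> nat \<Rightarrow> 'v set \<Rightarrow> 'v \<Rightarrow> nat \<times> nat" where
  "rank G p X v = (LEAST r. fst r \<in> levels G p X \<and> v \<in> stage G p X (fst r) (snd r))"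

text \<open>
  The choice of successor is not unique, hence a predicate. Outside the
  layered attractor the strategy is arbitrary. On it \<open>i > 0\<close> always holds, as
  $A_{d,0} = \emptyset$, so \<open>i - 1\<close> is not truncated.
\<close>

definition layered_attr_strategy ::
    "'v pgame \<Rightarrow> nat \<Rightarrow> 'v set \<Rightarrow> ('v \<Rightarrow> 'v) \<Rightarrow> bool" where
  "layered_attr_strategy G p X \<tau> \<longleftrightarrow>
     strategy G p \<tau> \<and>
     (\<forall>v \<in> owned G p \<inter> layered_attr G p X. \<forall>d i. rank G p X v = (d, i) \<longrightarrow>
        \<tau> v \<in> succs G v \<inter> (stage G p X d (i - 1) \<union> prev_layer G p X d \<union> targets G X d))"

lemma layered_attr_strategy_exists:
  assumes G: "parity_game G" and p: "p \<in> {0, 1}" and X: "X \<subseteq> nodes G" "X \<noteq> {}"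
    and par: "\<forall>v\<in>X. color G v mod 2 = p"
  shows "\<exists>\<tau>. layered_attr_strategy G p X \<tau>"
proof -
  have "finite X" using G X(1) by (auto simp: parity_game_def intro: finite_subset)
  then have "max_color G X \<in> color G ` X"
    unfolding max_color_def using X(2) by (intro Max_in) auto
  then have "max_color G X mod 2 = p" using par by auto
  then have lev: "max_color G X \<in> levels G p X"
    by (auto simp: levels_def)
  have dis: "owned G p \<inter> owned G (1 - p) = {}" and sub: "owned G p \<subseteq> nodes G"
    using G p by (auto simp: parity_game_def owned_def)
  have "\<exists>w. w \<in> succs G v \<and> (v \<in> layered_attr G p X \<longrightarrow>
          (\<forall>d i. rank G p X v = (d, i) \<longrightarrow>
             w \<in> stage G p X d (i - 1) \<union> prev_layer G p X d \<union> targets G X d))"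
    if v: "v \<in> owned G p" for v
  proof (cases "v \<in> layered_attr G p X")
    case False
    then show ?thesis using v sub G by (auto simp: parity_game_def succs_def)
  next
    case True
    then obtain j where "v \<in> stage G p X (max_color G X) j"
      by (auto simp: layered_attr_def layer_eq_UN_stage)
    then have ex: "fst (max_color G X, j) \<in> levels G p X \<and>
        v \<in> stage G p X (fst (max_color G X, j)) (snd (max_color G X, j))"
      using lev by simp
    obtain d i where r: "rank G p X v = (d, i)" by fastforce
    have "v \<in> stage G p X d i"
      using LeastI[where P = "\<lambda>r. fst r \<in> levels G p X \<and> v \<in> stage G p X (fst r) (snd r)", OF ex] r
      unfolding rank_def by simp
    then obtain i' where i: "i = Suc i'" and
      "v \<in> pmpre G p (stage G p X d i') (prev_layer G p X d \<union> targets G X d) d"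
      by (cases i) (auto simp: stage_def)
    then have "succs G v \<inter> (stage G p X d i' \<union> (prev_layer G p X d \<union> targets G X d)) \<noteq> {}"
      using v dis by (auto simp: pmpre_def)
    then show ?thesis using r i by auto
  qed
  then obtain \<tau> where "\<forall>v\<in>owned G p. \<tau> v \<in> succs G v \<and> (v \<in> layered_attr G p X \<longrightarrow>
          (\<forall>d i. rank G p X v = (d, i) \<longrightarrow>
             \<tau> v \<in> stage G p X d (i - 1) \<union> prev_layer G p X d \<union> targets G X d))"
    by metis
  then have "layered_attr_strategy G p X \<tau>"
    unfolding layered_attr_strategy_def strategy_def by blast
  then show ?thesis by blast
qed

end

theory Submission
  imports Defs "HOL-Library.Infinite_Set"
begin

text \<open>
  A node of rank \<open>(d, i)\<close> has color at least \<open>d\<close> or lies in \<open>X\<close>, and a consistent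
  play moves from it to a node of smaller rank or to a node of \<open>X\<close> with color at most \<open>d\<close>.
  Suppose that the least color \<open>m\<close> seen infinitely often had the wrong parity. A node of
  color \<open>m\<close> lies outside \<open>X\<close>, so its rank \<open>(d, i)\<close> has \<open>d < m\<close>. Once colors below \<open>m\<close> no
  longer occur, the second kind of move is impossible from ranks with \<open>d < m\<close>, so from there
  the rank decreases forever.
\<close>

lemma pmpreD:
  assumes "parity_game G" "p \<in> {0, 1}" "v \<in> pmpre G p A T d"
  shows "d \<le> color G v \<or> v \<in> T"
    and "v \<notin> owned G p \<Longrightarrow> succs G v \<subseteq> A \<union> T"
  using assms by (auto simp: pmpre_def owned_def parity_game_def split: if_splits)

text \<open>The threshold constrains only the color of \<open>v\<close> itself, never its
  successors. It may therefore be replaced freely once the condition on \<open>v\<close> is known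
  for \<open>d'\<close>, which allows raising the level.\<close>

lemma pmpre_mono:
  assumes "v \<in> pmpre G p A T d" "A \<union> T \<subseteq> A' \<union> T'" "d' \<le> color G v \<or> v \<in> T'"
  shows "v \<in> pmpre G p A' T' d'"
  using assms unfolding pmpre_def by blast

lemma stage_Suc:
  "stage G p X d (Suc i) = pmpre G p (stage G p X d i) (prev_layer G p X d \<union> targets G X d) d"
  by (simp add: stage_def)

lemma stage_0: "stage G p X d 0 = {}"
  by (simp add: stage_def)

text \<open>At level \<open>d\<close> the nodes of the previous layer are themselves targets, so the
  higher color bound does not exclude them. The successors that put them into the previous layer are
  targets at level \<open>d\<close> too, by induction and because \<open>targets\<close> grows with
  the level.\<close>

lemma prev_layer_subset_layer: "prev_layer G p X d \<subseteq> layer G p X d"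
proof (induction d rule: less_induct)
  case (less d)
  show ?case
  proof (cases "d < p + 2")
    case True
    then show ?thesis by (simp add: prev_layer_def)
  next
    case False
    then have prev: "prev_layer G p X d = layer G p X (d - 2)"
      by (simp add: prev_layer_def)
    show ?thesis
    proof
      fix v assume v: "v \<in> prev_layer G p X d"
      then obtain i where "v \<in> stage G p X (d - 2) (Suc i)"
        unfolding prev layer_eq_UN_stage by (metis UN_E stage_0 empty_iff not0_implies_Suc)
      then have *: "v \<in> pmpre G p (stage G p X (d - 2) i)
          (prev_layer G p X (d - 2) \<union> targets G X (d - 2)) (d - 2)"
        by (simp add: stage_Suc)
      have "prev_layer G p X (d - 2) \<subseteq> layer G p X (d - 2)"
        using False by (intro less.IH) auto
      moreover have "stage G p X (d - 2) i \<subseteq> layer G p X (d - 2)"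
        by (auto simp: layer_eq_UN_stage)
      moreover have "targets G X (d - 2) \<subseteq> targets G X d"
        by (auto simp: targets_def)
      \<comment> \<open>One iteration suffices: everything needed is already in the target set,
        although \<open>stage G p X d 0\<close> is empty.\<close>
      ultimately have "v \<in> stage G p X d (Suc 0)"
        unfolding stage_Suc using v prev by (intro pmpre_mono[OF *]) auto
      then show "v \<in> layer G p X d" by (auto simp: layer_eq_UN_stage)
    qed
  qed
qed

text \<open>The bound \<open>p \<le> d\<close> keeps \<open>d + 2 * Suc k\<close> out of the empty
  base case of \<open>prev_layer\<close>.\<close>

lemma layer_subset_layer_add: "p \<le> d \<Longrightarrow> layer G p X d \<subseteq> layer G p X (d + 2 * k)"
proof (induction k)
  case (Suc k)
  then show ?case
    using prev_layer_subset_layer[of G p X "d + 2 * Suc k"] by (auto simp: prev_layer_def)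
qed simp

lemma layer_subset_layered_attr:
  assumes "d \<in> levels G p X" "max_color G X mod 2 = p"
  shows "layer G p X d \<subseteq> layered_attr G p X"
proof -
  have "2 dvd max_color G X - d" and "p \<le> d" and "d \<le> max_color G X"
    using assms mod_eq_dvd_iff_nat[of d "max_color G X" 2] by (auto simp: levels_def)
  then obtain k where "max_color G X = d + 2 * k"
    by (metis dvdE le_add_diff_inverse)
  then show ?thesis
    using layer_subset_layer_add[OF \<open>p \<le> d\<close>, of G X k] by (simp add: layered_attr_def)
qed

lemma max_color_mod:
  assumes "parity_game G" "X \<subseteq> nodes G" "X \<noteq> {}" "\<forall>v\<in>X. color G v mod 2 = p"
  shows "max_color G X mod 2 = p"
proof -
  have "finite X" using assms(1,2) by (auto simp: parity_game_def intro: finite_subset)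
  then have "max_color G X \<in> color G ` X"
    unfolding max_color_def using assms(3) by (intro Max_in) auto
  then show ?thesis using assms(4) by auto
qed

lemma rank_le:
  assumes "d \<in> levels G p X" "v \<in> stage G p X d i"
  shows "rank G p X v \<le> (d, i)"
  unfolding rank_def using assms by (intro Least_le) auto

lemma rank_stage:
  assumes "max_color G X mod 2 = p" "v \<in> layered_attr G p X" "rank G p X v = (d, i)"
  shows "d \<in> levels G p X" "v \<in> stage G p X d i"
proof -
  obtain j where "v \<in> stage G p X (max_color G X) j"
    using assms(2) by (auto simp: layered_attr_def layer_eq_UN_stage)
  \<comment> \<open>Every node of the layered attractor thus has a candidate rank at the top level,
    so the \<open>LEAST\<close> in \<open>rank\<close> is attained.\<close>
  moreover have "max_color G X \<in> levels G p X"
    using assms(1) by (auto simp: levels_def)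
  ultimately have "fst (max_color G X, j) \<in> levels G p X \<and>
      v \<in> stage G p X (fst (max_color G X, j)) (snd (max_color G X, j))"
    by simp
  from LeastI[where P = "\<lambda>r. fst r \<in> levels G p X \<and> v \<in> stage G p X (fst r) (snd r)", OF this]
  show "d \<in> levels G p X" "v \<in> stage G p X d i"
    using assms(3) unfolding rank_def by simp_all
qed

text \<open>The first component already drops, so \<open>i\<close> is arbitrary. Membership in
  \<open>prev_layer\<close> forces \<open>d\<close> to be at least \<open>p + 2\<close>, hence
  \<open>d - 2\<close> is not truncated.\<close>

lemma prev_layer_rank_less:
  assumes "d \<in> levels G p X" "v \<in> prev_layer G p X d"
  shows "rank G p X v < (d, i)"
proof -
  have d: "\<not> d < p + 2" and "v \<in> layer G p X (d - 2)"
    using assms(2) by (auto simp: prev_layer_def split: if_splits)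
  then obtain j where j: "v \<in> stage G p X (d - 2) j"
    by (auto simp: layer_eq_UN_stage)
  have "d - 2 \<in> levels G p X"
    using assms(1) d le_mod_geq[of 2 d] by (auto simp: levels_def)
  then have "rank G p X v \<le> (d - 2, j)"
    using j by (rule rank_le)
  also have "\<dots> < (d, i)" using d by auto
  finally show ?thesis .
qed

lemma winner_eqI:
  assumes "p \<in> {0, 1}" "(LEAST k. \<exists>\<^sub>\<infinity>n. color G (\<pi> n) = k) mod 2 = p"
  shows "winner G \<pi> = p"
  unfolding winner_def even_iff_mod_2_eq_zero assms(2) using assms(1) by auto

lemma least_recurring:
  fixes f :: "nat \<Rightarrow> nat"
  assumes "finite (range f)"
  defines "m \<equiv> LEAST k. \<exists>\<^sub>\<infinity>n. f n = k"
  shows "\<exists>\<^sub>\<infinity>n. f n = m" "\<forall>\<^sub>\<infinity>n. m \<le> f n"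
proof -
  obtain k where "\<exists>\<^sub>\<infinity>n. f n = k"
    using pigeonhole_infinite[OF infinite_UNIV_nat assms(1)]
    by (auto simp: INFM_iff_infinite)
  then show "\<exists>\<^sub>\<infinity>n. f n = m" unfolding m_def by (rule LeastI)
  have "\<forall>\<^sub>\<infinity>n. f n \<noteq> k" if "k < m" for k
    using not_less_Least[OF that[unfolded m_def]] by (simp add: not_INFM)
  \<comment> \<open>Only finitely many values lie below \<open>m\<close>, so one bound on the
    position serves all of them.\<close>
  then have "\<forall>\<^sub>\<infinity>n. \<forall>k\<in>{..<m}. f n \<noteq> k"
    by (intro eventually_ball_finite) auto
  then show "\<forall>\<^sub>\<infinity>n. m \<le> f n"
    by (rule MOST_mono) (metis lessThan_iff not_le)
qed

theorem theorem4:
  fixes G :: "'v pgame" and p :: nat and X :: "'v set" and \<tau> :: "'v \<Rightarrow> 'v"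
  assumes "parity_game G"
    and "p \<in> {0, 1}"
    and "X \<subseteq> nodes G"
    and "X \<noteq> {}"
    and "\<forall>v\<in>X. color G v mod 2 = p"
    and "fatal G p X"
    and "layered_attr_strategy G p X \<tau>"
  shows "winning_on G p \<tau> (layered_attr G p X)"
  unfolding winning_on_def
proof (intro allI impI, elim conjE)
  fix \<pi> assume play: "play G \<pi>" and start: "\<pi> 0 \<in> layered_attr G p X"
    and cons: "consistent G p \<tau> \<pi>"
  let ?W = "layered_attr G p X" and ?r = "rank G p X"
  note mc = max_color_mod[OF assms(1,3-5)]
  have XW: "X \<subseteq> ?W" using assms(6) by (simp add: fatal_def)

  have inv: "d \<in> levels G p X" "d \<le> color G v \<or> v \<in> X"
    if v: "v \<in> ?W" and r: "?r v = (d, i)" for v d i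
  proof -
    show d: "d \<in> levels G p X" using rank_stage[OF mc v r] by simp
    obtain j where "v \<in> stage G p X d (Suc j)"
      using rank_stage(2)[OF mc v r] by (metis stage_0 empty_iff not0_implies_Suc)
    then have "d \<le> color G v \<or> v \<in> prev_layer G p X d \<union> targets G X d"
      unfolding stage_Suc by (rule pmpreD(1)[OF assms(1,2)])
    \<comment> \<open>Otherwise the rank of \<open>v\<close> would be smaller than itself.\<close>
    moreover have "v \<notin> prev_layer G p X d"
      using prev_layer_rank_less[OF d, of v i] r by auto
    ultimately show "d \<le> color G v \<or> v \<in> X" by (auto simp: targets_def)
  qed

  have step: "\<pi> (Suc n) \<in> ?W \<and> (?r (\<pi> (Suc n)) < (d, i) \<or> \<pi> (Suc n) \<in> targets G X d)"
    if v: "\<pi> n \<in> ?W" and r: "?r (\<pi> n) = (d, i)" for n d i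
  proof -
    have d: "d \<in> levels G p X" using rank_stage[OF mc v r] by simp
    \<comment> \<open>Stage 0 is empty, so \<open>i\<close> is positive and the stage
      \<open>i - 1\<close> prescribed by the strategy is \<open>j\<close>.\<close>
    obtain j where j: "i = Suc j"
      using rank_stage(2)[OF mc v r] by (metis stage_0 empty_iff not0_implies_Suc)
    have st: "\<pi> n \<in> pmpre G p (stage G p X d j) (prev_layer G p X d \<union> targets G X d) d"
      using rank_stage(2)[OF mc v r] by (simp add: j stage_Suc)
    have suc: "\<pi> (Suc n) \<in> succs G (\<pi> n)" using play by (simp add: play_def)
    have mem: "\<pi> (Suc n) \<in> stage G p X d j \<union> prev_layer G p X d \<union> targets G X d"
    proof (cases "\<pi> n \<in> owned G p")
      case True
      then show ?thesis
        using assms(7) cons v r j by (fastforce simp: layered_attr_strategy_def consistent_def)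
    next
      case False
      then show ?thesis using pmpreD(2)[OF assms(1,2) st] suc by blast
    qed
    have "stage G p X d j \<subseteq> ?W" "prev_layer G p X d \<subseteq> ?W"
      using layer_subset_layered_attr[OF d mc] prev_layer_subset_layer[of G p X d]
      by (auto simp: layer_eq_UN_stage)
    \<comment> \<open>Fatality enters here: a move to a target may raise the rank, but it does not
      leave the attractor.\<close>
    moreover have "targets G X d \<subseteq> ?W" using XW by (auto simp: targets_def)
    moreover have "?r (\<pi> (Suc n)) < (d, i)" if "\<pi> (Suc n) \<in> stage G p X d j"
    proof -
      have "?r (\<pi> (Suc n)) \<le> (d, j)" using d that by (rule rank_le)
      also have "\<dots> < (d, i)" by (simp add: j)
      finally show ?thesis .
    qed
    moreover have "?r (\<pi> (Suc n)) < (d, i)" if "\<pi> (Suc n) \<in> prev_layer G p X d"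
      using d that by (rule prev_layer_rank_less)
    ultimately show ?thesis using mem by blast
  qed

  have W: "\<pi> n \<in> ?W" for n
  proof (induction n)
    case (Suc n)
    then show ?case using step[of n] by (cases "?r (\<pi> n)") blast
  qed (rule start)

  have "\<pi> n \<in> nodes G" for n
    using play assms(1) by (cases n) (auto simp: play_def succs_def parity_game_def)
  then have "range (\<lambda>n. color G (\<pi> n)) \<subseteq> color G ` nodes G" by auto
  then have "finite (range (\<lambda>n. color G (\<pi> n)))"
    by (rule finite_subset) (use assms(1) in \<open>simp add: parity_game_def\<close>)
  note recurring = least_recurring[OF this]
  define m where "m = (LEAST k. \<exists>\<^sub>\<infinity>n. color G (\<pi> n) = k)"

  have "m mod 2 = p"
  proof (rule ccontr)
    assume wrong: "m mod 2 \<noteq> p"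
    obtain N where N: "m \<le> color G (\<pi> n)" if "N \<le> n" for n
      using recurring(2) unfolding m_def MOST_nat_le by blast
    obtain n0 where n0: "N \<le> n0" "color G (\<pi> n0) = m"
      using recurring(1) unfolding m_def INFM_nat_le by blast
    have "fst (?r (\<pi> n0)) < m"
    proof -
      obtain d i where r: "?r (\<pi> n0) = (d, i)" by fastforce
      have "\<pi> n0 \<notin> X" using assms(5) n0(2) wrong by auto
      then have "d \<le> m" "d mod 2 = p"
        using inv[OF W r] n0(2) by (auto simp: levels_def)
      \<comment> \<open>The case \<open>d = m\<close> is excluded because \<open>d\<close> has
        parity \<open>p\<close> and \<open>m\<close> does not.\<close>
      then show ?thesis using r wrong by (cases "d = m") auto
    qed
    moreover have dec: "?r (\<pi> (Suc n)) < ?r (\<pi> n)" if "n0 \<le> n" "fst (?r (\<pi> n)) < m" for n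
    proof -
      obtain d i where r: "?r (\<pi> n) = (d, i)" by fastforce
      have "m \<le> color G (\<pi> (Suc n))" using that n0 by (intro N) simp
      then show ?thesis using step[OF W r] r that(2) by (auto simp: targets_def)
    qed
    \<comment> \<open>A lexicographic decrease never raises the first component, so the bound
      \<open>m\<close> persists and \<open>dec\<close> applies at every later position.\<close>
    ultimately have low: "fst (?r (\<pi> (n0 + k))) < m" for k
    proof (induction k)
      case (Suc k)
      then have "?r (\<pi> (Suc (n0 + k))) < ?r (\<pi> (n0 + k))" by simp
      then have "fst (?r (\<pi> (Suc (n0 + k)))) \<le> fst (?r (\<pi> (n0 + k)))"
        by (auto simp: less_prod_def)
      then show ?case using Suc by simp
    qed simp
    have "\<And>k. ?r (\<pi> (n0 + Suc k)) < ?r (\<pi> (n0 + k))"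
      using dec low by simp
    then show False
      using wf_no_infinite_down_chainE[OF wf, of "\<lambda>k. ?r (\<pi> (n0 + k))"] by blast
  qed
  then show "winner G \<pi> = p"
    using assms(2) by (intro winner_eqI) (simp_all add: m_def)
qed

end
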